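(* Let $\{(x_n,y_n)\}_{n\ge0}$ be the position process of the infinitely repeated cooperative two-player bus game on the circuit of length $D$ (defined in the context), in which at each stage the players use the optimal cooperative strategies. Let $d=T(v_{max}-v_{min})$, let $d_n=\min\{d_{\mathbf x}(x_n,y_n),d_{\mathbf y}(x_n,y_n)\}$ for $n\ge0$, and let $N=\min\left\{n\ge0: d_n=\frac D2\right\}$. Then for all $d_0\ge0$, $$N\le\left\lceil\frac{D}{2d}\right\rceil,$$ where $\lceil z\rceil$ is the least integer greater than or equal to $z$.
   Context: Fix real constants $D>0$, $T>0$, $0<v_{min}<v_{max}$, with $Tv_{max}<D/2$; speeds lie in $\Gamma=[v_{min},v_{max}]$. For real $r$ let $(r)_{mod\,D}=D\left(\frac rD-\lfloor \frac rD\rfloor\right)\in[0,D)$. For positions $x,y\in[0,D)$ the directed distances are $$d_{\mathbf x}(x,y)=\begin{cases} y-x & x\le y\\ D+y-x & x>y\end{cases},\qquad d_{\mathbf y}(x,y)=\begin{cases} x-y & y\le x\\ D+x-y & y>x.\end{cases}$$ The process. Start from $(x_0,y_0)\in[0,D)^2$. Given $(x_n,y_n)$ with $d_n=\min\{d_{\mathbf x}(x_n,y_n),d_{\mathbf y}(x_n,y_n)\}$, the players choose speeds $(v_{\mathbf x},v_{\mathbf y})\in\Gamma\times\Gamma$ and $x_{n+1}=(x_n+Tv_{\mathbf x})_{mod\,D}$, $y_{n+1}=(y_n+Tv_{\mathbf y})_{mod\,D}$. When $d_n=d_{\mathbf x}(x_n,y_n)$ the speeds are chosen as follows (when instead $d_n=d_{\mathbf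 y}(x_n,y_n)$, the roles of $\mathbf x$ and $\mathbf y$ are exchanged): (a) if $d_n=0$: $(v_{\mathbf x},v_{\mathbf y})$ is either $(v_{min},v_{max})$ or $(v_{max},v_{min})$; (b) if $0<d_n$ and $d_n+d<\frac D2$: $(v_{\mathbf x},v_{\mathbf y})=(v_{min},v_{max})$; (c) if $d_n+d\ge\frac D2$: $(v_{\mathbf x},v_{\mathbf y})$ is any pair in $\Gamma\times\Gamma$ with $d_n+T(v_{\mathbf y}-v_{\mathbf x})=\frac D2$. (These are the strategies the paper identifies as optimal in the one-stage cooperative game, where the players jointly seek to equalize their payoffs, each payoff being an affine function of the directed distance from the player's own final position to the other's.) *)

theory Defs
  imports Complex_Main
begin

definition circ_mod :: "real \<Rightarrow> real \<Rightarrow> real" where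
  "circ_mod D r = D * (r / D - of_int \<lfloor>r / D\<rfloor>)"

definition dist_x :: "real \<Rightarrow> real \<Rightarrow> real \<Rightarrow> real" where
  "dist_x D x y = (if x \<le> y then y - x else D + y - x)"

definition dist_y :: "real \<Rightarrow> real \<Rightarrow> real \<Rightarrow> real" where
  "dist_y D x y = (if y \<le> x then x - y else D + x - y)"

definition circ_dist :: "real \<Rightarrow> real \<Rightarrow> real \<Rightarrow> real" where
  "circ_dist D x y = min (dist_x D x y) (dist_y D x y)"

definition stage_gain :: "real \<Rightarrow> real \<Rightarrow> real \<Rightarrow> real" where
  "stage_gain T vmin vmax = T * (vmax - vmin)"

(* Here u is the speed of the player from whom the current distance e is
   measured (the one behind) and w is the speed of the other player.  The three
   cases are mutually exclusive, since e is nonnegative and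
   stage_gain T vmin vmax < D / 2. *)
definition coop_speeds ::
  "real \<Rightarrow> real \<Rightarrow> real \<Rightarrow> real \<Rightarrow> real \<Rightarrow> real \<Rightarrow> real \<Rightarrow> bool" where
  "coop_speeds D T vmin vmax e u w \<longleftrightarrow>
     u \<in> {vmin..vmax} \<and> w \<in> {vmin..vmax} \<and>
     (e = 0 \<and> ((u, w) = (vmin, vmax) \<or> (u, w) = (vmax, vmin)) \<or>
      0 < e \<and> e + stage_gain T vmin vmax < D / 2 \<and> (u, w) = (vmin, vmax) \<or>
      e + stage_gain T vmin vmax \<ge> D / 2 \<and> e + T * (w - u) = D / 2)"

(* If both directed distances coincide (both are 0 or both are D / 2), the two
   disjuncts admit the same speed pairs. *)
definition coop_choice ::
  "real \<Rightarrow> real \<Rightarrow> real \<Rightarrow> real \<Rightarrow> real \<Rightarrow> real \<Rightarrow> real \<Rightarrow> real \<Rightarrow> bool" where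
  "coop_choice D T vmin vmax x y vx vy \<longleftrightarrow>
     circ_dist D x y = dist_x D x y \<and> coop_speeds D T vmin vmax (circ_dist D x y) vx vy \<or>
     circ_dist D x y = dist_y D x y \<and> coop_speeds D T vmin vmax (circ_dist D x y) vy vx"

definition coop_process ::
  "real \<Rightarrow> real \<Rightarrow> real \<Rightarrow> real \<Rightarrow> (nat \<Rightarrow> real) \<Rightarrow> (nat \<Rightarrow> real) \<Rightarrow> bool" where
  "coop_process D T vmin vmax x y \<longleftrightarrow>
     x 0 \<in> {0..<D} \<and> y 0 \<in> {0..<D} \<and>
     (\<forall>n. \<exists>vx vy. coop_choice D T vmin vmax (x n) (y n) vx vy \<and>
        x (Suc n) = circ_mod D (x n + T * vx) \<and>
        y (Suc n) = circ_mod D (y n + T * vy))"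

end

(* Modulo D, the signed distance from the player behind to the player ahead changes by
   T (w - u) in a stage, and the circular distance is the absolute value of its
   representative in [-D/2, D/2].  Hence each stage replaces d_n by min (d_n + d) (D/2). *)
theory Submission
  imports Defs
begin

lemma circ_mod_eq: "D > 0 \<Longrightarrow> circ_mod D r = r - of_int \<lfloor>r / D\<rfloor> * D"
  by (simp add: circ_mod_def field_simps)

lemma circ_mod_range:
  assumes "D > 0"
  shows "circ_mod D r \<in> {0..<D}"
proof -
  have "frac (r / D) \<ge> 0" "frac (r / D) < 1"
    by (simp_all add: frac_lt_1)
  with assms show ?thesis
    by (simp add: circ_mod_def frac_def)
qed

lemma circ_dist_commute: "circ_dist D x y = circ_dist D y x"
  by (auto simp: circ_dist_def dist_x_def dist_y_def)

lemma circ_dist_nonneg: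
  assumes "x \<in> {0..<D}" "y \<in> {0..<D}"
  shows "circ_dist D x y \<ge> 0"
  using assms by (auto simp: circ_dist_def dist_x_def dist_y_def)

text \<open>If \<open>f\<close> is nonzero, the two directed distances are
  \<open>\<bar>f\<bar>\<close> and \<open>D - \<bar>f\<bar>\<close>, and the bound on
  \<open>f\<close> makes the first the smaller; if \<open>f = 0\<close>, the positions
  coincide.\<close>

lemma circ_dist_eq_abs:
  assumes x: "x \<in> {0..<D}" and y: "y \<in> {0..<D}"
    and diff: "y - x = f + of_int k * D" and f: "\<bar>f\<bar> \<le> D / 2"
  shows "circ_dist D x y = \<bar>f\<bar>"
proof -
  have D: "D > 0" using x by simp
  \<comment> \<open>Both positions lie in one period, so \<open>\<bar>y - x\<bar> < D\<close>; with
    \<open>\<bar>f\<bar> \<le> D / 2\<close> this leaves \<open>\<bar>k\<bar> < 2\<close>.\<close>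
  have "of_int k * D < 2 * D" "- 2 * D < of_int k * D"
    using x y diff f D unfolding atLeastLessThan_iff by linarith+
  then have "of_int k < (2 :: real)" "- 2 < (of_int k :: real)"
    using D mult_less_cancel_right_pos[OF D] by blast+
  then have "k = - 1 \<or> k = 0 \<or> k = 1" by linarith
  then show ?thesis
    using x y diff f
    by (elim disjE) (auto simp: circ_dist_def dist_x_def dist_y_def min_def abs_if)
qed

lemma circ_dist_step:
  assumes D: "D > 0"
    and e: "circ_dist D x y = dist_x D x y" "circ_dist D x y \<ge> 0"
    and sp: "coop_speeds D T vmin vmax (circ_dist D x y) u w"
    and gain: "0 \<le> stage_gain T vmin vmax" "stage_gain T vmin vmax < D / 2"
  shows "circ_dist D (circ_mod D (x + T * u)) (circ_mod D (y + T * w)) =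
    min (circ_dist D x y + stage_gain T vmin vmax) (D / 2)"
proof -
  let ?e = "circ_dist D x y"
  define f where "f = ?e + T * (w - u)"
  \<comment> \<open>\<open>j\<close> records whether the arc from \<open>x\<close> to
    \<open>y\<close> crosses the origin: \<open>-1\<close> if it does, \<open>0\<close>
    otherwise.\<close>
  obtain j :: int where j: "y - x = ?e + of_int j * D"
  proof (cases "x \<le> y")
    case True
    then show ?thesis using that[of 0] e by (simp add: dist_x_def)
  next
    case False
    then show ?thesis using that[of "-1"] e by (simp add: dist_x_def)
  qed
  \<comment> \<open>At distance 0 either player may be the faster, so \<open>f\<close> is plus or
    minus the gain, which is below \<open>D / 2\<close>. In the other cases \<open>f\<close> is
    \<open>?e\<close> plus the gain, or exactly \<open>D / 2\<close>.\<close>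
  have abs_f: "\<bar>f\<bar> = min (?e + stage_gain T vmin vmax) (D / 2)"
    using sp gain e D unfolding coop_speeds_def f_def
    by (auto simp: stage_gain_def min_def abs_if algebra_simps)
  \<comment> \<open>Reducing the new positions changes their difference only by multiples of
    \<open>D\<close>, so \<open>f\<close> still represents it.\<close>
  have "circ_mod D (y + T * w) - circ_mod D (x + T * u) =
      f + of_int (j - \<lfloor>(y + T * w) / D\<rfloor> + \<lfloor>(x + T * u) / D\<rfloor>) * D"
    using j D by (simp add: circ_mod_eq f_def algebra_simps)
  from circ_dist_eq_abs[OF circ_mod_range[OF D] circ_mod_range[OF D] this]
  show ?thesis using abs_f by (metis min.cobounded2)
qed

text \<open>Exchanging the players swaps the directed distances and preserves
  \<open>circ_dist\<close>, so both disjuncts of \<open>coop_choice\<close> reduce to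
  \<open>circ_dist_step\<close>.\<close>

lemma coop_choice_step:
  assumes "x \<in> {0..<D}" "y \<in> {0..<D}" "coop_choice D T vmin vmax x y vx vy"
    and "0 \<le> stage_gain T vmin vmax" "stage_gain T vmin vmax < D / 2"
  shows "circ_dist D (circ_mod D (x + T * vx)) (circ_mod D (y + T * vy)) =
    min (circ_dist D x y + stage_gain T vmin vmax) (D / 2)"
proof -
  have D: "D > 0" and nonneg: "circ_dist D x y \<ge> 0"
    using assms(1) circ_dist_nonneg[OF assms(1,2)] by auto
  have swap: "dist_y D x y = dist_x D y x"
    by (simp add: dist_x_def dist_y_def)
  from assms(3) show ?thesis
    unfolding coop_choice_def
  proof (elim disjE conjE)
    assume "circ_dist D x y = dist_x D x y" "coop_speeds D T vmin vmax (circ_dist D x y) vx vy"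
    then show ?thesis using circ_dist_step D nonneg assms(4,5) by blast
  next
    assume "circ_dist D x y = dist_y D x y" "coop_speeds D T vmin vmax (circ_dist D x y) vy vx"
    then show ?thesis
      using circ_dist_step[of D y x T vmin vmax vy vx] D nonneg assms(4,5) swap
      by (simp add: circ_dist_commute)
  qed
qed

lemma coop_process_range:
  assumes "D > 0" "coop_process D T vmin vmax x y"
  shows "x n \<in> {0..<D}" "y n \<in> {0..<D}"
proof -
  have "x n \<in> {0..<D} \<and> y n \<in> {0..<D}"
  proof (cases n)
    case 0
    then show ?thesis using assms by (simp add: coop_process_def)
  next
    case (Suc m)
    then show ?thesis
      using assms circ_mod_range[OF assms(1)] unfolding coop_process_def by metis
  qed
  then show "x n \<in> {0..<D}" "y n \<in> {0..<D}" by auto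
qed

lemma coop_process_dist_Suc:
  assumes "D > 0" "coop_process D T vmin vmax x y"
    and "0 \<le> stage_gain T vmin vmax" "stage_gain T vmin vmax < D / 2"
  shows "circ_dist D (x (Suc n)) (y (Suc n)) =
    min (circ_dist D (x n) (y n) + stage_gain T vmin vmax) (D / 2)"
proof -
  obtain vx vy where "coop_choice D T vmin vmax (x n) (y n) vx vy"
    "x (Suc n) = circ_mod D (x n + T * vx)" "y (Suc n) = circ_mod D (y n + T * vy)"
    using assms(2) unfolding coop_process_def by blast
  then show ?thesis
    using coop_choice_step coop_process_range[OF assms(1,2)] assms(3,4) by simp
qed

text \<open>The map sending \<open>e\<close> to \<open>min (e + gain) (D / 2)\<close> is monotone,
  so a start at distance 0 is the worst case; its orbit is the right-hand side.\<close>

lemma coop_process_dist_ge: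
  assumes "D > 0" "coop_process D T vmin vmax x y"
    and "0 \<le> stage_gain T vmin vmax" "stage_gain T vmin vmax < D / 2"
  shows "circ_dist D (x n) (y n) \<ge> min (of_nat n * stage_gain T vmin vmax) (D / 2)"
proof (induction n)
  case 0
  then show ?case
    using circ_dist_nonneg[OF coop_process_range[OF assms(1,2)]] by (simp add: min_le_iff_disj)
next
  case (Suc n)
  have "of_nat (Suc n) * stage_gain T vmin vmax =
      of_nat n * stage_gain T vmin vmax + stage_gain T vmin vmax"
    by (simp add: algebra_simps)
  with Suc show ?case
    using coop_process_dist_Suc[OF assms, of n] assms(3) by linarith
qed

theorem theorem4:
  fixes D T vmin vmax d :: real and x y :: "nat \<Rightarrow> real"
  assumes "D > 0" and "T > 0" and "0 < vmin" and "vmin < vmax" and "T * vmax < D / 2"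
    and "d = stage_gain T vmin vmax"
    and "coop_process D T vmin vmax x y"
  shows "(\<exists>n. circ_dist D (x n) (y n) = D / 2) \<and>
    int (LEAST n. circ_dist D (x n) (y n) = D / 2) \<le> \<lceil>D / (2 * d)\<rceil>"
proof -
  have d: "0 < d"
    using assms by (simp add: stage_gain_def)
  \<comment> \<open>Positivity of \<open>vmin\<close> puts \<open>d\<close> strictly below
    \<open>T * vmax\<close>, hence below \<open>D / 2\<close>.\<close>
  have "0 < T * vmin" using assms by simp
  moreover have "d = T * vmax - T * vmin"
    using assms(6) by (simp add: stage_gain_def algebra_simps)
  ultimately have d2: "d < D / 2" using assms(5) by linarith
  \<comment> \<open>\<open>K\<close> is the least number of stages with
    \<open>K * d \<ge> D / 2\<close>.\<close>
  define K where "K = nat \<lceil>D / (2 * d)\<rceil>"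
  have "0 < D / (2 * d)" using d assms(1) by simp
  then have K: "int K = \<lceil>D / (2 * d)\<rceil>" and "K \<noteq> 0"
    unfolding K_def by linarith+
  \<comment> \<open>The recurrence supplies the cap \<open>D / 2\<close> at successor indices, so
    \<open>K\<close> is written as one.\<close>
  then obtain m where m: "K = Suc m" using not0_implies_Suc by blast
  have "D / (2 * d) \<le> of_nat K" using K by linarith
  then have "D / 2 \<le> of_nat K * d" using d by (simp add: field_simps)
  then have "circ_dist D (x K) (y K) \<ge> D / 2"
    using coop_process_dist_ge[OF assms(1,7), of K] d d2 assms(6) by simp
  moreover have "circ_dist D (x K) (y K) \<le> D / 2"
    using coop_process_dist_Suc[OF assms(1,7), of m] d d2 assms(6) m
    by (metis less_imp_le min.cobounded2)
  ultimately have eq: "circ_dist D (x K) (y K) = D / 2" by simp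
  have "(LEAST n. circ_dist D (x n) (y n) = D / 2) \<le> K"
    by (rule Least_le) (rule eq)
  with K eq show ?thesis by auto
qed

end
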